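(* Let $n\in\mathbb N$, $\alpha>0$, $1<p<\infty$ and $\frac1p+\frac1{p'}=1$. For nonzero $g\in\mathcal{H}^n_{p,\alpha}$ and nonzero $h\in\mathcal{H}^n_{p',\alpha}$ set \[ \mathcal{R}_{p,\alpha}(g,h)=\frac{|\langle g,h\rangle_\alpha|}{\|g\|_{p,\alpha}\|h\|_{p',\alpha}}. \] Then \[ C_p^{n/2}\le \sup_{g\in\mathcal{H}^n_{p,\alpha}\setminus\{0\}}\ \sup_{h\in\mathcal{H}^n_{p',\alpha}\setminus\{0\}}\mathcal{R}_{p,\alpha}(g,h)\le C_p^n. \]
   Context: For $\alpha>0$ and $n\in\mathbb N$, $\gamma^n_\alpha(dz)=(\alpha/\pi)^n e^{-\alpha|z|^2}\lambda^n(dz)$ on $\mathbb C^n$, with $\lambda^n$ Lebesgue measure. For $1\le p<\infty$, $\mathcal{H}^n_{p,\alpha}$ is the space of holomorphic $f$ on $\mathbb C^n$ with $\|f\|_{p,\alpha}:=\left(\int|f|^p\,d\gamma^n_{\alpha p/2}\right)^{1/p}<\infty$. $\langle f,g\rangle_\alpha=\int f\overline{g}\,d\gamma^n_\alpha$. $C_p=2\,p^{-1/p}\,(p')^{-1/p'}$. *)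

theory Defs
  imports "HOL-Analysis.Analysis"
begin

definition entire_several :: "(complex ^ 'n \<Rightarrow> complex) \<Rightarrow> bool" where
  "entire_several f \<longleftrightarrow>
     (\<forall>z. \<exists>L. (f has_derivative L) (at z) \<and> (\<forall>c v. L (c *s v) = c * L v))"

definition gauss :: "real \<Rightarrow> (complex ^ 'n) measure" where
  "gauss a = density lborel
      (\<lambda>z. ennreal ((a / pi) ^ CARD('n) * exp (- a * (norm z)\<^sup>2)))"

definition fock :: "real \<Rightarrow> real \<Rightarrow> (complex ^ 'n \<Rightarrow> complex) set" where
  "fock p a = {f. entire_several f \<and> f \<in> borel_measurable borel \<and>
      (\<integral>\<^sup>+ z. ennreal (norm (f z) powr p) \<partial>(gauss (a * p / 2))) < \<infinity>}"

definition fock_norm :: "real \<Rightarrow> real \<Rightarrow> (complex ^ 'n \<Rightarrow> complex) \<Rightarrow> real" where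
  "fock_norm p a f = (integral\<^sup>L (gauss (a * p / 2)) (\<lambda>z. norm (f z) powr p)) powr (1 / p)"

definition gauss_inner :: "real \<Rightarrow> (complex ^ 'n \<Rightarrow> complex) \<Rightarrow> (complex ^ 'n \<Rightarrow> complex) \<Rightarrow> complex" where
  "gauss_inner a f g = integral\<^sup>L (gauss a) (\<lambda>z. f z * cnj (g z))"

definition Cp :: "real \<Rightarrow> real" where
  "Cp p = 2 * p powr (- 1 / p) * (p / (p - 1)) powr (- (p - 1) / p)"

definition ratio :: "real \<Rightarrow> real \<Rightarrow> real \<Rightarrow> (complex ^ 'n \<Rightarrow> complex) \<Rightarrow> (complex ^ 'n \<Rightarrow> complex) \<Rightarrow> real" where
  "ratio p q a g h = norm (gauss_inner a g h) / (fock_norm p a g * fock_norm q a h)"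

end

theory Submission
  imports Defs "HOL-Probability.Characteristic_Functions"
begin

text \<open>
  Absorbing the weight \<open>exp (- a |z|\<^sup>2 / 2)\<close> into \<open>g\<close> and \<open>h\<close> turns the pairing and both norms into
  unweighted Lebesgue integrals, so the upper bound is Hoelder's inequality; the constant
  \<open>Cp p ^ n\<close> is what remains of the normalisations of the three Gaussian measures.

  For the lower bound, test with \<open>g z = exp (a b (\<Sum>i. z\<^sub>i\<^sup>2) / 2)\<close> and \<open>h z = exp (a d (\<Sum>i. z\<^sub>i\<^sup>2) / 2)\<close>,
  where \<open>-1 < b, d < 1\<close>. Everything factors over coordinates, and Gaussian integration gives the ratio
  \<open>((1 - b d)\<^sup>-\<^sup>1 (1 - b\<^sup>2) powr (1/p) (1 - d\<^sup>2) powr (1/q)) powr (n/2)\<close>.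
  With \<open>b = 1 - \<epsilon>/p\<close> and \<open>d = 1 - \<epsilon>/q\<close> the powers of \<open>\<epsilon>\<close> cancel, and the limit as \<open>\<epsilon>\<close> tends
  to 0 is \<open>Cp p powr (n/2)\<close>.
\<close>

section \<open>Lebesgue measure on vectors as a product over coordinates\<close>

lemma borel_measurable_vec_lambda [measurable]:
  "(\<lambda>f. \<chi> i. f i) \<in> borel_measurable (\<Pi>\<^sub>M i\<in>(UNIV :: 'n::finite set). (borel :: 'a::euclidean_space measure))"
proof (subst borel_measurable_euclidean_space, intro ballI)
  fix b :: "'a^'n" assume "b \<in> Basis"
  then obtain i c where "b = axis i c" by (auto simp: Basis_vec_def)
  then show "(\<lambda>f. (\<chi> i. f i) \<bullet> b) \<in> borel_measurable (\<Pi>\<^sub>M i\<in>UNIV. (borel :: 'a measure))"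
    by (simp add: inner_axis) measurable
qed

text \<open>Lebesgue measure is determined by the volumes of boxes. The preimage of a box under the
  vector constructor is a product of boxes in the coordinates, so its product measure is the product
  of their volumes.\<close>

lemma lborel_vec_eq:
  "(lborel :: ('a::euclidean_space ^ 'n) measure) = distr (\<Pi>\<^sub>M i\<in>UNIV. lborel) borel (\<lambda>f. \<chi> i. f i)"
proof (rule lborel_eqI)
  interpret finite_product_sigma_finite "\<lambda>_. lborel :: 'a measure" "UNIV :: 'n set"
    by standard auto
  have [measurable]: "(\<lambda>f. \<chi> i. f i) \<in> borel_measurable (\<Pi>\<^sub>M i\<in>(UNIV :: 'n set). (lborel :: 'a measure))"
    by (subst measurable_cong_sets[OF sets_PiM_cong[OF refl sets_lborel] refl]) measurable
  fix l u :: "'a^'n" assume le: "\<And>b. b \<in> Basis \<Longrightarrow> l \<bullet> b \<le> u \<bullet> b"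
  have le': "l $ i \<bullet> b \<le> u $ i \<bullet> b" if "b \<in> Basis" for i b
    using le[of "axis i b"] that by (auto simp: inner_axis axis_in_Basis_iff)
  have eq: "(\<lambda>f. \<chi> i. f i) -` box l u \<inter> space (\<Pi>\<^sub>M i\<in>(UNIV :: 'n set). (lborel :: 'a measure))
      = (\<Pi>\<^sub>E i\<in>UNIV. box (l $ i) (u $ i))"
    by (auto simp: space_PiM mem_box Basis_vec_def inner_axis PiE_iff)
  \<comment> \<open>Indexing the basis by pairs \<open>(i, c)\<close> turns the double product over
    coordinates and their basis vectors into one product over \<open>Basis\<close>. Injectivity
    holds because basis vectors are nonzero.\<close>
  have B: "(Basis :: ('a^'n) set) = (\<lambda>(i, c). axis i c) ` (UNIV \<times> Basis)"
    by (auto simp: Basis_vec_def)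
  have inj: "inj_on (\<lambda>(i, c). axis i c) (UNIV \<times> (Basis :: 'a set))"
    by (auto simp: inj_on_def axis_eq_axis dest: nonzero_Basis)
  have "emeasure (distr (\<Pi>\<^sub>M i\<in>UNIV. lborel) borel (\<lambda>f. \<chi> i. f i)) (box l u)
      = (\<Prod>i\<in>UNIV. emeasure lborel (box (l $ i) (u $ i)))"
    by (subst emeasure_distr) (auto simp: eq measure_times)
  also have "\<dots> = (\<Prod>i\<in>UNIV. ennreal (\<Prod>c\<in>Basis. (u $ i - l $ i) \<bullet> c))"
    by (simp add: emeasure_lborel_box le')
  also have "\<dots> = ennreal (\<Prod>i\<in>UNIV. \<Prod>c\<in>Basis. (u $ i - l $ i) \<bullet> c)"
    by (rule prod_ennreal) (auto intro!: prod_nonneg simp: inner_diff_left le')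
  also have "(\<Prod>i\<in>UNIV. \<Prod>c\<in>Basis. (u $ i - l $ i) \<bullet> c) = (\<Prod>b\<in>Basis. (u - l) \<bullet> b)"
    unfolding B prod.reindex[OF inj] by (simp add: prod.cartesian_product o_def case_prod_beta inner_axis)
  finally show "emeasure (distr (\<Pi>\<^sub>M i\<in>UNIV. lborel) borel (\<lambda>f. \<chi> i. f i)) (box l u)
      = ennreal (\<Prod>b\<in>Basis. (u - l) \<bullet> b)" .
qed simp

text \<open>Fubini for a product of copies of one function: the change of variables to the product
  measure makes the integral factor, and equal factors give a power. This reduces every later
  integral to the complex plane.\<close>

lemma
  fixes f :: "'a::euclidean_space \<Rightarrow> 'b::{real_normed_field,banach,second_countable_topology}"
  assumes f: "integrable lborel f"
  shows integrable_lborel_vec_prod: "integrable lborel (\<lambda>z :: 'a^'n. \<Prod>i\<in>UNIV. f (z $ i))"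
    and integral_lborel_vec_prod:
      "(\<integral>z. (\<Prod>i\<in>UNIV. f (z $ i)) \<partial>(lborel :: ('a^'n) measure)) = (\<integral>w. f w \<partial>lborel) ^ CARD('n)"
proof -
  interpret finite_product_sigma_finite "\<lambda>_. lborel :: 'a measure" "UNIV :: 'n set"
    by standard auto
  have m: "(\<lambda>f. \<chi> i. f i) \<in> borel_measurable (\<Pi>\<^sub>M i\<in>(UNIV :: 'n set). (lborel :: 'a measure))"
    by (subst measurable_cong_sets[OF sets_PiM_cong[OF refl sets_lborel] refl]) measurable
  have [measurable]: "f \<in> borel_measurable borel"
    using borel_measurable_integrable[OF f] by simp
  have mz: "(\<lambda>z :: 'a^'n. z $ i) \<in> borel_measurable borel" for i
    by (intro borel_measurable_continuous_onI continuous_intros)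
  have mf: "(\<lambda>z :: 'a^'n. \<Prod>i\<in>UNIV. f (z $ i)) \<in> borel_measurable borel"
    by (intro borel_measurable_prod measurable_compose[OF mz]) measurable
  show "integrable lborel (\<lambda>z :: 'a^'n. \<Prod>i\<in>UNIV. f (z $ i))"
    unfolding lborel_vec_eq using product_integrable_prod[of UNIV "\<lambda>_. f"] f
    by (subst integrable_distr_eq[OF m mf]) simp
  show "(\<integral>z. (\<Prod>i\<in>UNIV. f (z $ i)) \<partial>(lborel :: ('a^'n) measure)) = (\<integral>w. f w \<partial>lborel) ^ CARD('n)"
    unfolding lborel_vec_eq using product_integral_prod[of UNIV "\<lambda>_. f"] f
    by (subst integral_distr[OF m mf]) simp
qed

section \<open>Gaussian integrals on the line and in the complex plane\<close>

lemma lborel_complex_eq: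
  "(lborel :: complex measure) = distr (lborel \<Otimes>\<^sub>M lborel) borel (\<lambda>(x, y). Complex x y)"
proof (rule lborel_eqI)
  have m [measurable]: "(\<lambda>(x, y). Complex x y) \<in> borel_measurable (lborel \<Otimes>\<^sub>M lborel)"
    unfolding Complex_eq case_prod_beta by measurable
  fix l u :: complex assume le: "\<And>b. b \<in> Basis \<Longrightarrow> l \<bullet> b \<le> u \<bullet> b"
  have le': "Re l \<le> Re u" "Im l \<le> Im u"
    using le[of 1] le[of \<i>] by (auto simp: Basis_complex_def inner_complex_def)
  have "(\<lambda>(x, y). Complex x y) -` box l u = {Re l<..<Re u} \<times> {Im l<..<Im u}"
    by (auto simp: mem_box Basis_complex_def inner_complex_def)
  then show "emeasure (distr (lborel \<Otimes>\<^sub>M lborel) borel (\<lambda>(x, y). Complex x y)) (box l u)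
      = ennreal (\<Prod>b\<in>Basis. (u - l) \<bullet> b)"
    by (subst emeasure_distr)
      (auto simp: space_pair_measure lborel.emeasure_pair_measure_Times le' Basis_complex_def
        inner_complex_def ennreal_mult)
qed simp

text \<open>A rescaling turns the integral into the characteristic function of the standard normal
  distribution at \<open>t / s\<close>, whose value is known.\<close>

lemma
  fixes A t :: real
  assumes A: "A > 0"
  shows integrable_gaussian_fourier: "integrable lborel (\<lambda>x. complex_of_real (exp (- A * x\<^sup>2)) * cis (t * x))"
    and integral_gaussian_fourier:
      "(\<integral>x. complex_of_real (exp (- A * x\<^sup>2)) * cis (t * x) \<partial>lborel)
        = complex_of_real (sqrt (pi / A) * exp (- t\<^sup>2 / (4 * A)))"
proof -
  \<comment> \<open>With this scale, \<open>std_normal_density (s * x)\<close> equals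
    \<open>exp (- A * x\<^sup>2) / sqrt (2 * pi)\<close>.\<close>
  define s where "s = sqrt (2 * A)"
  have s: "s > 0" "s\<^sup>2 = 2 * A" using A by (auto simp: s_def)
  define f where "f = (\<lambda>x. complex_of_real (std_normal_density x) * cis (t / s * x))"
  have fi: "integrable lborel f"
  proof (rule Bochner_Integration.integrable_bound)
    show "integrable lborel std_normal_density" by simp
    show "f \<in> borel_measurable lborel"
      unfolding f_def cis_conv_exp by measurable
  qed (simp add: f_def norm_mult)
  have "(\<integral>x. f x \<partial>lborel) = char std_normal_distribution (t / s)"
    unfolding char_def f_def
    by (subst integral_density) (auto simp: cis_conv_exp scaleR_conv_of_real mult_ac)
  also have "\<dots> = complex_of_real (exp (- t\<^sup>2 / (4 * A)))"
    by (simp add: char_std_normal_distribution power_divide s)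
  finally have fI: "(\<integral>x. f x \<partial>lborel) = complex_of_real (exp (- t\<^sup>2 / (4 * A)))" .
  have eq: "complex_of_real (exp (- A * x\<^sup>2)) * cis (t * x) = complex_of_real (sqrt (2 * pi)) * f (0 + s * x)" for x
    using s by (simp add: f_def std_normal_density_def power_mult_distrib)
  show "integrable lborel (\<lambda>x. complex_of_real (exp (- A * x\<^sup>2)) * cis (t * x))"
    unfolding eq using lborel_integrable_real_affine[OF fi, of s 0] s by auto
  have "complex_of_real s * (\<integral>x. f (0 + s * x) \<partial>lborel) = complex_of_real (exp (- t\<^sup>2 / (4 * A)))"
    using lborel_integral_real_affine[of s f 0] s fI by (simp add: scaleR_conv_of_real)
  then have "(\<integral>x. f (0 + s * x) \<partial>lborel) = complex_of_real (exp (- t\<^sup>2 / (4 * A)) / s)"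
    using s by (simp add: nonzero_eq_divide_eq mult.commute)
  then have "(\<integral>x. complex_of_real (exp (- A * x\<^sup>2)) * cis (t * x) \<partial>lborel)
      = complex_of_real (sqrt (2 * pi) / s * exp (- t\<^sup>2 / (4 * A)))"
    unfolding eq by simp
  also have "sqrt (2 * pi) / s = sqrt (pi / A)"
    by (simp add: s_def real_sqrt_divide[symmetric])
  finally show "(\<integral>x. complex_of_real (exp (- A * x\<^sup>2)) * cis (t * x) \<partial>lborel)
        = complex_of_real (sqrt (pi / A) * exp (- t\<^sup>2 / (4 * A)))" .
qed

text \<open>Integrating over the imaginary part first is a Fourier transform: the phase becomes the
  Gaussian factor \<open>exp (- (c * x)\<^sup>2 / (4 * B))\<close> in the real part x. This raises
  the rate A to \<open>A + c\<^sup>2 / (4 * B)\<close>, and a second Gaussian integral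
  remains.\<close>

lemma
  fixes A B c :: real
  assumes A: "A > 0" and B: "B > 0"
  shows integrable_complex_gaussian:
      "integrable lborel (\<lambda>z. complex_of_real (exp (- A * (Re z)\<^sup>2 - B * (Im z)\<^sup>2)) * cis (c * Re z * Im z))"
    and integral_complex_gaussian:
      "(\<integral>z. complex_of_real (exp (- A * (Re z)\<^sup>2 - B * (Im z)\<^sup>2)) * cis (c * Re z * Im z) \<partial>lborel)
        = complex_of_real (pi / sqrt (A * B + c\<^sup>2 / 4))"
proof -
  define f where "f = (\<lambda>z. complex_of_real (exp (- A * (Re z)\<^sup>2 - B * (Im z)\<^sup>2)) * cis (c * Re z * Im z))"
  define g where "g = (\<lambda>(x, y). f (Complex x y))"
  have g: "g (x, y) = complex_of_real (exp (- A * x\<^sup>2))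
      * (complex_of_real (exp (- B * y\<^sup>2)) * cis (c * x * y))" for x y
    by (simp add: g_def f_def exp_diff exp_minus field_simps)
  have m: "(\<lambda>(x, y). Complex x y) \<in> borel_measurable (lborel \<Otimes>\<^sub>M lborel)"
    unfolding Complex_eq case_prod_beta by measurable
  have mf: "f \<in> borel_measurable borel"
    unfolding f_def cis_conv_exp by measurable
  have mg: "g \<in> borel_measurable (lborel \<Otimes>\<^sub>M lborel)"
    using measurable_compose[OF m mf] by (simp add: g_def case_prod_beta')
  have ri: "integrable lborel (\<lambda>x. exp (- D * x\<^sup>2))" if "D > 0" for D :: real
    using integrable_norm[OF integrable_gaussian_fourier[OF that, of 0]] by (simp add: norm_mult)
  \<comment> \<open>Taking norms removes the phase, so absolute integrability concerns only a
    product of two real Gaussians.\<close>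
  have gi: "integrable (lborel \<Otimes>\<^sub>M lborel) g"
  proof (rule lborel_pair.Fubini_integrable[OF mg])
    show "integrable lborel (\<lambda>x. LBINT y. norm (g (x, y)))"
      using ri[OF A] by (simp add: g norm_mult)
    show "AE x in lborel. integrable lborel (\<lambda>y. g (x, y))"
      unfolding g using integrable_gaussian_fourier[OF B] by simp
  qed
  show "integrable lborel f"
    using gi unfolding lborel_complex_eq integrable_distr_eq[OF m mf]
    by (simp add: g_def case_prod_beta')
  have AB: "A + c\<^sup>2 / (4 * B) > 0" using A B by (intro add_pos_nonneg) auto
  have "(\<integral>z. f z \<partial>lborel) = (\<integral>z. g z \<partial>(lborel \<Otimes>\<^sub>M lborel))"
    unfolding lborel_complex_eq integral_distr[OF m mf] by (simp add: g_def case_prod_beta')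
  also have "\<dots> = (\<integral>x. (\<integral>y. g (x, y) \<partial>lborel) \<partial>lborel)"
    by (rule lborel_pair.integral_fst'[OF gi, symmetric])
  \<comment> \<open>The trivial factor \<open>cis (0 * x)\<close> keeps the integrand in the form of
    the one-dimensional Fourier integral, now at frequency 0.\<close>
  also have "\<dots> = (\<integral>x. complex_of_real (sqrt (pi / B))
      * (complex_of_real (exp (- (A + c\<^sup>2 / (4 * B)) * x\<^sup>2)) * cis (0 * x)) \<partial>lborel)"
  proof (rule Bochner_Integration.integral_cong[OF refl])
    fix x :: real
    have "(\<integral>y. g (x, y) \<partial>lborel) = complex_of_real (exp (- A * x\<^sup>2))
        * complex_of_real (sqrt (pi / B) * exp (- (c * x)\<^sup>2 / (4 * B)))"
      unfolding g by (subst integral_gaussian_fourier[OF B, symmetric]) simp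
    also have "\<dots> = complex_of_real (sqrt (pi / B) * exp (- A * x\<^sup>2 + - (c * x)\<^sup>2 / (4 * B)))"
      unfolding exp_add by simp
    also have "- A * x\<^sup>2 + - (c * x)\<^sup>2 / (4 * B) = - (A + c\<^sup>2 / (4 * B)) * x\<^sup>2"
      by (simp add: power_mult_distrib algebra_simps)
    finally show "(\<integral>y. g (x, y) \<partial>lborel) = complex_of_real (sqrt (pi / B))
      * (complex_of_real (exp (- (A + c\<^sup>2 / (4 * B)) * x\<^sup>2)) * cis (0 * x))" by simp
  qed
  also have "\<dots> = complex_of_real (sqrt (pi / B) * sqrt (pi / (A + c\<^sup>2 / (4 * B))))"
    using integral_gaussian_fourier[OF AB, of 0] by simp
  also have "sqrt (pi / B) * sqrt (pi / (A + c\<^sup>2 / (4 * B))) = sqrt (pi\<^sup>2 / (A * B + c\<^sup>2 / 4))"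
    unfolding real_sqrt_mult[symmetric] using A B by (simp add: field_simps power2_eq_square)
  also have "\<dots> = pi / sqrt (A * B + c\<^sup>2 / 4)"
    by (simp add: real_sqrt_divide)
  finally show "(\<integral>z. f z \<partial>lborel) = complex_of_real (pi / sqrt (A * B + c\<^sup>2 / 4))" .
qed

section \<open>Hoelder's inequality for Bochner integrals\<close>

lemma Hoelder_inequality:
  fixes u v :: "'a \<Rightarrow> 'b::{real_normed_field,banach,second_countable_topology}"
  assumes pq: "p > 1" "q > 1" "1 / p + 1 / q = 1"
    and meas [measurable]: "u \<in> borel_measurable M" "v \<in> borel_measurable M"
    and iu: "integrable M (\<lambda>x. norm (u x) powr p)" and iv: "integrable M (\<lambda>x. norm (v x) powr q)"
  shows "norm (\<integral>x. u x * v x \<partial>M)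
      \<le> (\<integral>x. norm (u x) powr p \<partial>M) powr (1 / p) * (\<integral>x. norm (v x) powr q \<partial>M) powr (1 / q)"
proof -
  define U where "U = (\<integral>x. norm (u x) powr p \<partial>M)"
  define V where "V = (\<integral>x. norm (v x) powr q \<partial>M)"
  have nn: "U \<ge> 0" "V \<ge> 0" by (auto simp: U_def V_def)
  show ?thesis
  proof (cases "U = 0 \<or> V = 0")
    \<comment> \<open>The normalisation below divides by \<open>U\<close> and \<open>V\<close>. If
      one of them vanishes, the corresponding function is zero almost everywhere, and so is the
      product.\<close>
    case True
    have "AE x in M. u x * v x = 0"
    proof (cases "U = 0")
      case True
      then have "AE x in M. norm (u x) powr p = 0"
        using integral_nonneg_eq_0_iff_AE[OF iu] by (simp add: U_def)
      then show ?thesis by (rule AE_mp) auto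
    next
      case False
      then have "V = 0" using True by simp
      then have "AE x in M. norm (v x) powr q = 0"
        using integral_nonneg_eq_0_iff_AE[OF iv] by (simp add: V_def)
      then show ?thesis by (rule AE_mp) auto
    qed
    then have "(\<integral>x. u x * v x \<partial>M) = 0" by (rule integral_eq_zero_AE)
    then show ?thesis by simp
  next
    case False
    then have pos: "U > 0" "V > 0" using nn by auto
    define W where "W = U powr (1 / p) * V powr (1 / q)"
    have W: "W > 0" using pos by (simp add: W_def)
    \<comment> \<open>Young's inequality is applied to both factors divided by their norms. After
      multiplying back by \<open>W\<close>, integration leaves W(1/p + 1/q) = W.\<close>
    have le: "norm (u x * v x) \<le> W * (norm (u x) powr p / (p * U) + norm (v x) powr q / (q * V))" for x
    proof -
      have "norm (u x) / U powr (1 / p) * (norm (v x) / V powr (1 / q))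
          \<le> (norm (u x) / U powr (1 / p)) powr p / p + (norm (v x) / V powr (1 / q)) powr q / q"
        by (rule Youngs_inequality) (use pq in auto)
      also have "\<dots> = norm (u x) powr p / (p * U) + norm (v x) powr q / (q * V)"
        using pq pos by (simp add: powr_divide powr_powr mult.commute)
      finally show ?thesis using W by (simp add: W_def norm_mult field_simps)
    qed
    have i: "integrable M (\<lambda>x. W * (norm (u x) powr p / (p * U) + norm (v x) powr q / (q * V)))"
      using iu iv by simp
    have "integrable M (\<lambda>x. u x * v x)"
      by (rule Bochner_Integration.integrable_bound[OF i]) (auto intro!: AE_I2 order_trans[OF le] abs_ge_self)
    then have "(\<integral>x. norm (u x * v x) \<partial>M)
        \<le> (\<integral>x. W * (norm (u x) powr p / (p * U) + norm (v x) powr q / (q * V)) \<partial>M)"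
      by (intro integral_mono i le) simp
    then have "norm (\<integral>x. u x * v x \<partial>M)
        \<le> (\<integral>x. W * (norm (u x) powr p / (p * U) + norm (v x) powr q / (q * V)) \<partial>M)"
      by (rule order_trans[OF Bochner_Integration.integral_norm_bound])
    also have "\<dots> = W * (U / (p * U) + V / (q * V))"
      using iu iv by (simp add: U_def V_def)
    also have "\<dots> = W" using pos pq by simp
    finally show ?thesis by (simp add: W_def U_def V_def)
  qed
qed

section \<open>Real Gaussians, Gaussian measures and conjugate exponents\<close>

lemma
  fixes A B :: real
  assumes A: "A > 0" and B: "B > 0"
  shows integrable_real_gaussian: "integrable lborel (\<lambda>z. exp (- A * (Re z)\<^sup>2 - B * (Im z)\<^sup>2))"
    and integral_real_gaussian:
      "(\<integral>z. exp (- A * (Re z)\<^sup>2 - B * (Im z)\<^sup>2) \<partial>lborel) = pi / sqrt (A * B)"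
  using integrable_complex_gaussian[OF A B, of 0] integral_complex_gaussian[OF A B, of 0]
  by (simp_all add: complex_of_real_integrable_eq del: of_real_exp of_real_divide)

lemma integral_gauss:
  fixes f :: "complex^'n \<Rightarrow> 'b::{banach,second_countable_topology}"
  assumes "a > 0" "f \<in> borel_measurable borel"
  shows "(\<integral>z. f z \<partial>gauss a) = (a / pi) ^ CARD('n) *\<^sub>R (\<integral>z. exp (- a * (norm z)\<^sup>2) *\<^sub>R f z \<partial>lborel)"
  using assms unfolding gauss_def by (subst integral_density) (auto simp flip: scaleR_scaleR)

lemma integrable_gauss_iff:
  fixes f :: "complex^'n \<Rightarrow> 'b::{banach,second_countable_topology}"
  assumes "a > 0" "f \<in> borel_measurable borel"
  shows "integrable (gauss a) f \<longleftrightarrow> integrable lborel (\<lambda>z. exp (- a * (norm z)\<^sup>2) *\<^sub>R f z)"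
proof -
  have iff: "integrable lborel (\<lambda>z. c *\<^sub>R F z) \<longleftrightarrow> integrable lborel F"
    if "c \<noteq> 0" for c and F :: "complex^'n \<Rightarrow> 'b"
    using that integrable_scaleR_right[of "inverse c" lborel "\<lambda>z. c *\<^sub>R F z"] by auto
  show ?thesis
    using assms iff[of "(a / pi) ^ CARD('n)"] unfolding gauss_def
    by (subst integrable_density) (auto simp flip: scaleR_scaleR)
qed

lemma norm_vec_power2: "(norm (z :: 'a::real_normed_vector ^ 'n))\<^sup>2 = (\<Sum>i\<in>UNIV. (norm (z $ i))\<^sup>2)"
  by (simp add: norm_vec_def L2_set_def sum_nonneg)

text \<open>The quotient \<open>p / (p - 1)\<close> inside \<open>Cp\<close> is the conjugate
  exponent, and \<open>(p - 1) / p\<close> is its reciprocal. The symmetric form lets the powers of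
  p and q cancel separately.\<close>

lemma Cp_conjugate:
  assumes "1 < p" "1 / p + 1 / q = 1"
  shows "Cp p = 2 * p powr (- 1 / p) * q powr (- 1 / q)"
proof -
  have "1 / q = (p - 1) / p" using assms by (simp add: field_simps)
  then have "q = p / (p - 1)" by (metis divide_divide_eq_right div_by_1 mult_1 inverse_divide inverse_inverse_eq inverse_eq_divide)
  then show ?thesis using assms by (simp add: Cp_def)
qed

lemma conjugate_exponent_gt_1:
  fixes p q :: real
  assumes "1 < p" "1 / p + 1 / q = 1"
  shows "1 < q"
proof -
  have "1 / p < 1" "0 < 1 / p" using assms by auto
  then have "0 < 1 / q" "1 / q < 1" using assms by linarith+
  then show ?thesis by (simp add: divide_less_eq split: if_splits)
qed

section \<open>Weighted norms and the upper bound\<close>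

lemma fock_integrable:
  assumes "f \<in> fock p a"
  shows "integrable (gauss (a * p / 2)) (\<lambda>z. norm (f z) powr p)"
proof (rule integrableI_bounded)
  have [measurable]: "f \<in> borel_measurable borel" using assms by (simp add: fock_def)
  show "(\<lambda>z. norm (f z) powr p) \<in> borel_measurable (gauss (a * p / 2))"
    unfolding gauss_def by measurable
  show "(\<integral>\<^sup>+ z. ennreal (norm (norm (f z) powr p)) \<partial>gauss (a * p / 2)) < \<infinity>"
    using assms by (simp add: fock_def)
qed

text \<open>The p-th power of the weight \<open>exp (- (a / 2) * (norm z)\<^sup>2)\<close> is
  exactly the Gaussian of rate \<open>a * p / 2\<close>. Only the normalising constant of the
  measure is left over, raised to the power 1/p.\<close>

lemma
  fixes f :: "complex^'n \<Rightarrow> complex"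
  assumes f: "f \<in> fock p a" and a: "a > 0" and p: "p > 1"
  shows fock_weighted_integrable:
      "integrable lborel (\<lambda>z. norm (exp (- (a / 2) * (norm z)\<^sup>2) *\<^sub>R f z) powr p)"
    and fock_norm_weighted:
      "fock_norm p a f = (a * p / (2 * pi)) powr (real CARD('n) / p)
        * (\<integral>z. norm (exp (- (a / 2) * (norm z)\<^sup>2) *\<^sub>R f z) powr p \<partial>lborel) powr (1 / p)"
proof -
  have [measurable]: "f \<in> borel_measurable borel" using f by (simp add: fock_def)
  have ap: "a * p / 2 > 0" using a p by simp
  have eq: "norm (exp (- (a / 2) * (norm z)\<^sup>2) *\<^sub>R f z) powr p
      = exp (- (a * p / 2) * (norm z)\<^sup>2) *\<^sub>R (norm (f z) powr p)" for z
    by (simp add: powr_mult exp_powr_real mult_ac)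
  show "integrable lborel (\<lambda>z. norm (exp (- (a / 2) * (norm z)\<^sup>2) *\<^sub>R f z) powr p)"
    unfolding eq using fock_integrable[OF f] by (subst (asm) integrable_gauss_iff[OF ap]) auto
  show "fock_norm p a f = (a * p / (2 * pi)) powr (real CARD('n) / p)
        * (\<integral>z. norm (exp (- (a / 2) * (norm z)\<^sup>2) *\<^sub>R f z) powr p \<partial>lborel) powr (1 / p)"
    unfolding eq fock_norm_def using a p
    by (subst integral_gauss[OF ap]) (auto simp: powr_mult powr_powr simp flip: powr_realpow)
qed

lemma ratio_le:
  fixes g h :: "complex^'n \<Rightarrow> complex"
  assumes a: "a > 0" and p: "1 < p" and pq: "1 / p + 1 / q = 1"
    and g: "g \<in> fock p a" and h: "h \<in> fock q a"
  shows "ratio p q a g h \<le> Cp p powr real CARD('n)"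
proof -
  define n where "n = real CARD('n)"
  have q: "1 < q" using conjugate_exponent_gt_1[OF p pq] .
  have [measurable]: "g \<in> borel_measurable borel" "h \<in> borel_measurable borel"
    using g h by (simp_all add: fock_def)
  have [measurable]: "cnj \<in> borel_measurable borel"
    by (intro borel_measurable_continuous_onI continuous_intros)
  define w where "w = (\<lambda>z :: complex^'n. exp (- (a / 2) * (norm z)\<^sup>2))"
  define G where "G = (\<integral>z. norm (w z *\<^sub>R g z) powr p \<partial>lborel) powr (1 / p)"
  define H where "H = (\<integral>z. norm (w z *\<^sub>R h z) powr q \<partial>lborel) powr (1 / q)"
  have [measurable]: "w \<in> borel_measurable borel" unfolding w_def by measurable
  \<comment> \<open>The Gaussian in the pairing splits evenly, giving one weight to each function,
    as in the weighted norms.\<close>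
  have ww: "exp (- (a * (norm z)\<^sup>2)) = w z * w z" for z :: "complex^'n"
    by (simp add: w_def flip: exp_add)
  have "gauss_inner a g h = (a / pi) ^ CARD('n) *\<^sub>R (\<integral>z. (w z *\<^sub>R g z) * cnj (w z *\<^sub>R h z) \<partial>lborel)"
    unfolding gauss_inner_def using a by (subst integral_gauss) (auto simp: ww mult_ac)
  then have "norm (gauss_inner a g h)
      = (a / pi) powr n * norm (\<integral>z. (w z *\<^sub>R g z) * cnj (w z *\<^sub>R h z) \<partial>lborel)"
    using a by (simp add: norm_power n_def powr_realpow)
  also have "norm (\<integral>z. (w z *\<^sub>R g z) * cnj (w z *\<^sub>R h z) \<partial>lborel)
      \<le> (\<integral>z. norm (w z *\<^sub>R g z) powr p \<partial>lborel) powr (1 / p)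
        * (\<integral>z. norm (cnj (w z *\<^sub>R h z)) powr q \<partial>lborel) powr (1 / q)"
    using fock_weighted_integrable[OF g a p] fock_weighted_integrable[OF h a q]
    by (intro Hoelder_inequality[OF p q pq]) (auto simp: w_def)
  also have "\<dots> = G * H" by (simp add: G_def H_def)
  finally have le: "norm (gauss_inner a g h) \<le> (a / pi) powr n * (G * H)"
    using a by (simp add: mult_left_mono)
  \<comment> \<open>Bookkeeping of the constants: the powers of p and q in \<open>Cp p\<close>
    cancel those from the two norms, and the two powers of a/(2 pi) combine to a single one since
    1/p + 1/q = 1. The factor 2 then leaves a/pi, the constant of the pairing.\<close>
  have "Cp p powr n * ((a * p / (2 * pi)) powr (n / p) * (a * q / (2 * pi)) powr (n / q))
      = (Cp p * (a * p / (2 * pi)) powr (1 / p) * (a * q / (2 * pi)) powr (1 / q)) powr n"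
    using a p q by (simp add: powr_mult powr_powr Cp_def)
  also have "Cp p * (a * p / (2 * pi)) powr (1 / p) * (a * q / (2 * pi)) powr (1 / q)
      = 2 * ((a / (2 * pi)) powr (1 / p) * (a / (2 * pi)) powr (1 / q))
        * (p powr (- 1 / p) * p powr (1 / p)) * (q powr (- 1 / q) * q powr (1 / q))"
    unfolding Cp_conjugate[OF p pq] using a p q by (simp add: powr_mult powr_divide)
  also have "\<dots> = a / pi"
    unfolding powr_add[symmetric] pq using a p q by simp
  finally have C: "Cp p powr n * ((a * p / (2 * pi)) powr (n / p) * (a * q / (2 * pi)) powr (n / q))
      = (a / pi) powr n" .
  have N: "fock_norm p a g = (a * p / (2 * pi)) powr (n / p) * G"
    "fock_norm q a h = (a * q / (2 * pi)) powr (n / q) * H"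
    using fock_norm_weighted[OF g a p] fock_norm_weighted[OF h a q] by (simp_all add: n_def G_def H_def w_def)
  have D: "norm (gauss_inner a g h) \<le> Cp p powr n * (fock_norm p a g * fock_norm q a h)"
    using le by (simp add: N mult_ac flip: C)
  show ?thesis
  proof (cases "fock_norm p a g * fock_norm q a h = 0")
    case False
    then have "fock_norm p a g * fock_norm q a h > 0" by (simp add: fock_norm_def)
    then show ?thesis using D by (simp add: ratio_def divide_le_eq n_def)
  next
    \<comment> \<open>Division by zero yields 0, so here the ratio is 0 and the bound is
      nonnegative.\<close>
    case True
    then show ?thesis unfolding ratio_def by (simp only: True) simp
  qed
qed

section \<open>Quadratic exponentials as test functions\<close>

definition quad_exp :: "real \<Rightarrow> complex^'n \<Rightarrow> complex" where
  "quad_exp s z = exp (complex_of_real (s / 2) * (\<Sum>i\<in>UNIV. (z $ i)\<^sup>2))"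

lemma entire_several_quad_exp: "entire_several (quad_exp s :: complex^'n \<Rightarrow> complex)"
  unfolding entire_several_def
proof (intro allI exI conjI)
  fix z v :: "complex^'n" and c :: complex
  \<comment> \<open>This is the derivative given by the chain rule; its complex linearity is visible
    from the formula.\<close>
  let ?L = "\<lambda>v. quad_exp s z * (complex_of_real (s / 2) * (\<Sum>i\<in>UNIV. 2 * z $ i * v $ i))"
  have "((\<lambda>z. (z $ i)\<^sup>2) has_derivative (\<lambda>v. 2 * z $ i * v $ i)) (at z)" for i
    by (auto intro!: derivative_eq_intros bounded_linear_imp_has_derivative simp: power2_eq_square)
  then have "((\<lambda>z. complex_of_real (s / 2) * (\<Sum>i\<in>UNIV. (z $ i)\<^sup>2)) has_derivative
      (\<lambda>v. complex_of_real (s / 2) * (\<Sum>i\<in>UNIV. 2 * z $ i * v $ i))) (at z)"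
    by (intro has_derivative_mult_right has_derivative_sum)
  from has_derivative_compose[OF this DERIV_exp[unfolded has_field_derivative_def]]
  show "(quad_exp s has_derivative ?L) (at z)"
    by (simp add: quad_exp_def[abs_def])
  show "?L (c *s v) = c * ?L v"
    by (simp add: sum_distrib_left mult_ac)
qed

lemma continuous_quad_exp: "continuous_on UNIV (quad_exp s)"
  unfolding quad_exp_def[abs_def] by (intro continuous_intros)

lemma borel_measurable_quad_exp [measurable]: "quad_exp s \<in> borel_measurable borel"
  by (rule borel_measurable_continuous_onI[OF continuous_quad_exp])

lemma quad_exp_nonzero: "quad_exp s \<noteq> (\<lambda>z. 0)"
  by (auto simp: quad_exp_def fun_eq_iff)

lemma quad_exp_eq_prod: "quad_exp s z = (\<Prod>i\<in>UNIV. exp (complex_of_real (s / 2) * (z $ i)\<^sup>2))"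
  by (simp add: quad_exp_def sum_distrib_left exp_sum)

lemma exp_norm_vec_eq_prod:
  "exp (- a * (norm z)\<^sup>2) = (\<Prod>i\<in>UNIV. exp (- a * (norm (z $ i))\<^sup>2))"
  by (simp add: norm_vec_power2 sum_distrib_left exp_sum flip: sum_negf)

lemma power_inverse_sqrt: "x > 0 \<Longrightarrow> (1 / sqrt x) ^ n = x powr (- real n / 2)"
  by (simp add: powr_half_sqrt[symmetric] powr_minus_divide powr_powr power_divide powr_divide
    flip: powr_realpow)

text \<open>Since Re (w^2) = x^2 - y^2 for w = x + iy, the weighted P-th power is in each coordinate
  a real Gaussian with rates \<open>A\<close> in x and \<open>B\<close> in y. The condition |b| < 1
  makes both rates positive, and \<open>A * B\<close> produces the factor
  \<open>1 - b\<^sup>2\<close>.\<close>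

lemma
  fixes a b P :: real
  assumes a: "a > 0" and P: "P > 1" and b: "\<bar>b\<bar> < 1"
  shows quad_exp_in_fock: "(quad_exp (a * b) :: complex^'n \<Rightarrow> complex) \<in> fock P a"
    and fock_norm_quad_exp:
      "fock_norm P a (quad_exp (a * b) :: complex^'n \<Rightarrow> complex)
        = (1 - b\<^sup>2) powr (- real CARD('n) / 2 * (1 / P))"
proof -
  let ?g = "quad_exp (a * b) :: complex^'n \<Rightarrow> complex"
  define A where "A = P / 2 * (a * (1 - b))"
  define B where "B = P / 2 * (a * (1 + b))"
  define f where "f = (\<lambda>w. exp (- A * (Re w)\<^sup>2 - B * (Im w)\<^sup>2))"
  have AB: "A > 0" "B > 0" using a P b by (auto simp: A_def B_def)
  have b2: "1 - b\<^sup>2 > 0" using b by (simp add: abs_square_less_1)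
  have c: "exp (- (a * P / 2) * (norm w)\<^sup>2) * norm (exp (complex_of_real (a * b / 2) * w\<^sup>2)) powr P = f w" for w
    unfolding f_def norm_exp_eq_Re exp_powr_real exp_add[symmetric]
    by (rule arg_cong[where f = exp]) (simp add: A_def B_def cmod_power2 Re_power2 field_simps)
  have eq: "exp (- (a * P / 2) * (norm z)\<^sup>2) *\<^sub>R (norm (?g z) powr P) = (\<Prod>i\<in>UNIV. f (z $ i))" for z
    unfolding exp_norm_vec_eq_prod quad_exp_eq_prod prod_norm[symmetric]
    by (simp only: prod_powr_distrib real_scaleR_def c flip: prod.distrib)
  have aP: "a * P / 2 > 0" using a P by simp
  have m: "(\<lambda>z. norm (?g z) powr P) \<in> borel_measurable borel" by measurable
  have i: "integrable lborel f" unfolding f_def by (rule integrable_real_gaussian[OF AB])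
  have int: "integrable (gauss (a * P / 2)) (\<lambda>z. norm (?g z) powr P)"
    unfolding integrable_gauss_iff[OF aP m] eq by (rule integrable_lborel_vec_prod[OF i])
  then show "?g \<in> fock P a"
    by (simp add: fock_def entire_several_quad_exp integrable_iff_bounded)
  have "(\<integral>z. norm (?g z) powr P \<partial>gauss (a * P / 2)) = (a * P / 2 / pi * (pi / sqrt (A * B))) ^ CARD('n)"
    unfolding integral_gauss[OF aP m] eq integral_lborel_vec_prod[OF i]
    unfolding f_def integral_real_gaussian[OF AB] power_mult_distrib by simp
  also have "A * B = (a * P / 2)\<^sup>2 * (1 - b\<^sup>2)"
    by (simp add: A_def B_def power2_eq_square algebra_simps)
  also have "a * P / 2 / pi * (pi / sqrt ((a * P / 2)\<^sup>2 * (1 - b\<^sup>2))) = 1 / sqrt (1 - b\<^sup>2)"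
    using aP a P by (simp add: real_sqrt_mult)
  finally show "fock_norm P a ?g = (1 - b\<^sup>2) powr (- real CARD('n) / 2 * (1 / P))"
    unfolding fock_norm_def power_inverse_sqrt[OF b2] by (simp add: powr_powr)
qed

text \<open>In each coordinate the real parts of the exponents depend on the sum b + d and give the
  rates \<open>A\<close> and \<open>B\<close>, while the imaginary parts depend on b - d and give
  the phase \<open>c\<close>. In \<open>A * B + c\<^sup>2 / 4\<close> the squares of sum and
  difference combine to leave only the product b d.\<close>

lemma gauss_inner_quad_exp:
  fixes a b d :: real
  assumes a: "a > 0" and b: "\<bar>b\<bar> < 1" and d: "\<bar>d\<bar> < 1"
  shows "norm (gauss_inner a (quad_exp (a * b)) (quad_exp (a * d) :: complex^'n \<Rightarrow> complex))
    = (1 - b * d) powr (- real CARD('n) / 2)"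
proof -
  let ?g = "quad_exp (a * b) :: complex^'n \<Rightarrow> complex"
  let ?h = "quad_exp (a * d) :: complex^'n \<Rightarrow> complex"
  define A where "A = a * (1 - (b + d) / 2)"
  define B where "B = a * (1 + (b + d) / 2)"
  define c where "c = a * (b - d)"
  define f where "f = (\<lambda>w. complex_of_real (exp (- A * (Re w)\<^sup>2 - B * (Im w)\<^sup>2)) * cis (c * Re w * Im w))"
  have "- 2 < b + d" "b + d < 2" using b d by (auto simp: abs_less_iff)
  then have "1 - (b + d) / 2 > 0" "1 + (b + d) / 2 > 0" by (simp_all add: field_simps)
  then have AB: "A > 0" "B > 0" using a by (simp_all add: A_def B_def)
  have "\<bar>b * d\<bar> < 1" using mult_strict_mono'[OF b d] by (simp add: abs_mult)
  then have bd: "1 - b * d > 0" by simp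
  have f: "complex_of_real (exp (- a * (norm w)\<^sup>2))
      * (exp (complex_of_real (a * b / 2) * w\<^sup>2) * cnj (exp (complex_of_real (a * d / 2) * w\<^sup>2))) = f w" for w
    unfolding f_def exp_cnj exp_of_real[symmetric] cis_conv_exp exp_add[symmetric]
    by (rule arg_cong[where f = exp])
      (simp add: complex_eq_iff A_def B_def c_def cmod_power2, simp add: power2_eq_square field_simps)
  have eq: "exp (- a * (norm z)\<^sup>2) *\<^sub>R (?g z * cnj (?h z)) = (\<Prod>i\<in>UNIV. f (z $ i))" for z
    unfolding exp_norm_vec_eq_prod quad_exp_eq_prod scaleR_conv_of_real of_real_prod cnj_prod
    by (simp only: f flip: prod.distrib)
  have m: "(\<lambda>z. ?g z * cnj (?h z)) \<in> borel_measurable borel"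
    by (intro borel_measurable_continuous_onI continuous_intros continuous_quad_exp)
  have i: "integrable lborel f" unfolding f_def by (rule integrable_complex_gaussian[OF AB])
  have "gauss_inner a ?g ?h = complex_of_real ((a / pi * (pi / sqrt (A * B + c\<^sup>2 / 4))) ^ CARD('n))"
    unfolding gauss_inner_def integral_gauss[OF a m] eq integral_lborel_vec_prod[OF i]
    unfolding f_def integral_complex_gaussian[OF AB] scaleR_conv_of_real
    by (simp only: power_mult_distrib of_real_mult of_real_power)
  also have "A * B + c\<^sup>2 / 4 = a\<^sup>2 * (1 - b * d)"
    by (simp add: A_def B_def c_def power2_eq_square field_simps)
  also have "a / pi * (pi / sqrt (a\<^sup>2 * (1 - b * d))) = 1 / sqrt (1 - b * d)"
    using a by (simp add: real_sqrt_mult)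
  finally show ?thesis unfolding power_inverse_sqrt[OF bd] by simp
qed

section \<open>The ratio of the test functions and its limit\<close>

lemma ratio_quad_exp:
  fixes a p q \<epsilon> :: real
  assumes a: "a > 0" and p: "1 < p" and pq: "1 / p + 1 / q = 1" and e: "0 < \<epsilon>" "\<epsilon> < 1"
  shows "ratio p q a (quad_exp (a * (1 - \<epsilon> / p))) (quad_exp (a * (1 - \<epsilon> / q)) :: complex^'n \<Rightarrow> complex)
    = ((1 - \<epsilon> / (p * q)) powr (- 1) * ((2 - \<epsilon> / p) / p) powr (1 / p) * ((2 - \<epsilon> / q) / q) powr (1 / q))
        powr (real CARD('n) / 2)"
proof -
  define n where "n = real CARD('n) / 2"
  have q: "1 < q" using conjugate_exponent_gt_1[OF p pq] .
  define b where "b = 1 - \<epsilon> / p"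
  define d where "d = 1 - \<epsilon> / q"
  have ep: "0 < \<epsilon> / p" "\<epsilon> / p < 1" and eq: "0 < \<epsilon> / q" "\<epsilon> / q < 1"
    using p q e by (auto simp: field_simps)
  then have bd: "\<bar>b\<bar> < 1" "\<bar>d\<bar> < 1" by (auto simp: b_def d_def)
  have pq1: "1 < p * q" using p q by (metis less_1_mult)
  have epq: "\<epsilon> / (p * q) < 1" using pq1 e by (auto simp: field_simps)
  \<comment> \<open>The coefficient of the linear term is 1/p + 1/q = 1, so exactly one factor
    \<epsilon> splits off, as it also does from \<open>1 - b\<^sup>2\<close> and
    \<open>1 - d\<^sup>2\<close>.\<close>
  have "1 - b * d = \<epsilon> * (1 / p + 1 / q) - \<epsilon> * (\<epsilon> / (p * q))"
    by (simp add: b_def d_def algebra_simps)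
  then have 1: "1 - b * d = \<epsilon> * (1 - \<epsilon> / (p * q))"
    unfolding pq by (simp add: algebra_simps)
  have 2: "1 - b\<^sup>2 = \<epsilon> * ((2 - \<epsilon> / p) / p)" "1 - d\<^sup>2 = \<epsilon> * ((2 - \<epsilon> / q) / q)"
    by (simp_all add: b_def d_def power2_eq_square algebra_simps diff_divide_distrib)
  have pos: "0 < 1 - \<epsilon> / (p * q)" "0 < (2 - \<epsilon> / p) / p" "0 < (2 - \<epsilon> / q) / q"
    using ep eq epq p q by (auto intro!: divide_pos_pos simp del: less_divide_eq_1_pos divide_less_eq_1_pos)
  have "ratio p q a (quad_exp (a * b)) (quad_exp (a * d) :: complex^'n \<Rightarrow> complex)
      = (1 - b * d) powr (- n) / ((1 - b\<^sup>2) powr (- n * (1 / p)) * (1 - d\<^sup>2) powr (- n * (1 / q)))"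
    unfolding ratio_def gauss_inner_quad_exp[OF a bd] fock_norm_quad_exp[OF a p bd(1)]
      fock_norm_quad_exp[OF a q bd(2)] by (simp add: n_def)
  also have "\<dots> = (\<epsilon> powr (- n) / (\<epsilon> powr (- n * (1 / p)) * \<epsilon> powr (- n * (1 / q))))
      * ((1 - \<epsilon> / (p * q)) powr (- n) * ((2 - \<epsilon> / p) / p) powr (n * (1 / p)) * ((2 - \<epsilon> / q) / q) powr (n * (1 / q)))"
    unfolding 1 2 using pos e
    by (subst (1 2 3) powr_mult) (auto simp: powr_minus_divide)
  \<comment> \<open>By conjugacy the norms contribute the same power of \<epsilon> as the pairing,
    so the quotient has no singular factor left.\<close>
  also have "\<epsilon> powr (- n * (1 / p)) * \<epsilon> powr (- n * (1 / q)) = \<epsilon> powr (- n)"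
    unfolding powr_add[symmetric] distrib_left[symmetric] pq by simp
  also have "(1 - \<epsilon> / (p * q)) powr (- n) * ((2 - \<epsilon> / p) / p) powr (n * (1 / p)) * ((2 - \<epsilon> / q) / q) powr (n * (1 / q))
      = ((1 - \<epsilon> / (p * q)) powr (- 1) * ((2 - \<epsilon> / p) / p) powr (1 / p) * ((2 - \<epsilon> / q) / q) powr (1 / q)) powr n"
    by (simp only: powr_mult powr_powr powr_ge_zero mult_nonneg_nonneg) (simp add: mult.commute)
  finally show ?thesis using e by (simp add: b_def d_def n_def)
qed

text \<open>Once the powers of \<epsilon> have cancelled, the closed form is continuous at 0. Its
  base there is (2/p)^(1/p) (2/q)^(1/q), which is \<open>Cp p\<close> because the two powers of 2
  multiply to 2.\<close>

lemma ratio_quad_exp_tendsto: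
  fixes a p q :: real
  assumes a: "a > 0" and p: "1 < p" and pq: "1 / p + 1 / q = 1"
  shows "((\<lambda>\<epsilon>. ratio p q a (quad_exp (a * (1 - \<epsilon> / p))) (quad_exp (a * (1 - \<epsilon> / q)) :: complex^'n \<Rightarrow> complex))
    \<longlongrightarrow> Cp p powr (real CARD('n) / 2)) (at_right 0)"
proof (rule Lim_transform_eventually)
  have q: "1 < q" using conjugate_exponent_gt_1[OF p pq] .
  have "(1 - 0 / (p * q)) powr (- 1) * ((2 - 0 / p) / p) powr (1 / p) * ((2 - 0 / q) / q) powr (1 / q)
      = (2 powr (1 / p) * 2 powr (1 / q)) * p powr (- 1 / p) * q powr (- 1 / q)"
    using p q by (simp add: powr_divide powr_minus_divide)
  also have "\<dots> = Cp p" unfolding powr_add[symmetric] pq Cp_conjugate[OF p pq] by simp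
  finally have C: "(1 - 0 / (p * q)) powr (- 1) * ((2 - 0 / p) / p) powr (1 / p) * ((2 - 0 / q) / q) powr (1 / q)
      = Cp p" .
  \<comment> \<open>Positivity of the limiting base makes the outer power continuous there.
    Rewriting \<open>Cp p\<close> back into the closed form at 0 gives the limit the shape produced
    by the limit rules.\<close>
  have "Cp p > 0" using p by (simp add: Cp_def)
  then show "((\<lambda>\<epsilon>. ((1 - \<epsilon> / (p * q)) powr (- 1) * ((2 - \<epsilon> / p) / p) powr (1 / p)
      * ((2 - \<epsilon> / q) / q) powr (1 / q)) powr (real CARD('n) / 2)) \<longlongrightarrow> Cp p powr (real CARD('n) / 2)) (at_right 0)"
    using p q unfolding C[symmetric] by (intro tendsto_intros) auto
  show "\<forall>\<^sub>F \<epsilon> in at_right 0. ((1 - \<epsilon> / (p * q)) powr (- 1) * ((2 - \<epsilon> / p) / p) powr (1 / p)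
      * ((2 - \<epsilon> / q) / q) powr (1 / q)) powr (real CARD('n) / 2)
      = ratio p q a (quad_exp (a * (1 - \<epsilon> / p))) (quad_exp (a * (1 - \<epsilon> / q)) :: complex^'n \<Rightarrow> complex)"
    using eventually_at_right_real[OF zero_less_one]
    by eventually_elim (rule ratio_quad_exp[OF a p pq, symmetric], auto)
qed

theorem theorem1p5:
  fixes a p q :: real
  assumes "a > 0" and "1 < p" and "1 / p + 1 / q = 1"
  shows "ereal (Cp p powr (real CARD('n) / 2))
           \<le> (SUP g \<in> (fock p a :: (complex ^ 'n \<Rightarrow> complex) set) - {\<lambda>z. 0}.
                SUP h \<in> fock q a - {\<lambda>z. 0}. ereal (ratio p q a g h))
       \<and> (SUP g \<in> (fock p a :: (complex ^ 'n \<Rightarrow> complex) set) - {\<lambda>z. 0}.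
                SUP h \<in> fock q a - {\<lambda>z. 0}. ereal (ratio p q a g h))
           \<le> ereal (Cp p powr real CARD('n))"
proof
  have q: "1 < q" using conjugate_exponent_gt_1[OF assms(2,3)] .
  show "ereal (Cp p powr (real CARD('n) / 2))
           \<le> (SUP g \<in> (fock p a :: (complex ^ 'n \<Rightarrow> complex) set) - {\<lambda>z. 0}.
                SUP h \<in> fock q a - {\<lambda>z. 0}. ereal (ratio p q a g h))" (is "_ \<le> ?S")
  \<comment> \<open>The supremum dominates every ratio of the test family near 0, hence also the
    limit of these ratios.\<close>
  proof (rule tendsto_upperbound)
    show "((\<lambda>\<epsilon>. ereal (ratio p q a (quad_exp (a * (1 - \<epsilon> / p)))
        (quad_exp (a * (1 - \<epsilon> / q)) :: complex^'n \<Rightarrow> complex)))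
      \<longlongrightarrow> ereal (Cp p powr (real CARD('n) / 2))) (at_right 0)"
      by (intro tendsto_ereal ratio_quad_exp_tendsto assms)
    show "\<forall>\<^sub>F \<epsilon> in at_right 0. ereal (ratio p q a (quad_exp (a * (1 - \<epsilon> / p)))
        (quad_exp (a * (1 - \<epsilon> / q)) :: complex^'n \<Rightarrow> complex)) \<le> ?S"
      using eventually_at_right_real[OF zero_less_one]
    proof eventually_elim
      case (elim \<epsilon>)
      \<comment> \<open>These bounds place \<open>1 - \<epsilon> / p\<close> and
        \<open>1 - \<epsilon> / q\<close> strictly between 0 and 1, so both test functions belong to
        their Fock spaces.\<close>
      then have "0 < \<epsilon> / p" "\<epsilon> / p < 1" "0 < \<epsilon> / q" "\<epsilon> / q < 1"
        using assms q by (auto simp: field_simps)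
      then show ?case
        using assms q
        by (intro SUP_upper2[where i = "quad_exp (a * (1 - \<epsilon> / p))"]
            SUP_upper2[where i = "quad_exp (a * (1 - \<epsilon> / q))"])
          (auto intro!: quad_exp_in_fock simp: quad_exp_nonzero)
    qed
  qed simp
  show "?S \<le> ereal (Cp p powr real CARD('n))"
    by (intro SUP_least) (use assms in \<open>auto intro!: ratio_le\<close>)
qed

end
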